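(* The penalty function $$F_{\lambda}(x, \varepsilon) = f(x) + \varepsilon^{-1} d(y_0, \Phi(x))^2 + \lambda \varepsilon \quad (\varepsilon > 0)$$ is globally exact if and only if the penalty function $G_{\sigma}(x) = f(x) + \sigma d(y_0, \Phi(x))$ is globally exact, and (in this case) $$\lambda^* = \frac{(\sigma^* )^2}{4},$$ where $\lambda^*$ and $\sigma^*$ are the (global) exact penalty parameters of $F_\lambda$ and $G_{\sigma}$, respectively.
   Context: Setting: $X$ is a topological space, $(Y,d)$ is a metric space, $f \colon X \to \mathbb{R} \cup \{+\infty\}$, $\Phi \colon X \rightrightarrows Y$ is a set-valued mapping with closed values, $A \subset X$ is nonempty, $y_0 \in Y$ is fixed. Problem $(\mathcal{P})$: minimize $f(x)$ subject to $y_0 \in \Phi(x)$, $x \in A$. The feasible set is $\Omega = \{x \in A \mid y_0 \in \Phi(x)\}$; $\operatorname{dom} f = \{x \in X \mid f(x) < +\infty\}$. It is assumed that $\Omega \cap \operatorname{dom} f \neq \emptyset$ and $f$ is bounded below on $\Omega$. Here $d(y_0,\Phi(x)) = \inf_{z \in \Phi(x)} d(y_0,z)$ ($=+\infty$ if $\Phi(x)=\emptyset$). $\mathbb{R}_+ = [0,+\infty)$. Convention at $\varepsilon = 0$: $F_\lambda(x,0) = f(x)$ if $x$ is feasible, and $F_\lambda(x,0) = +\infty$ otherwise. Global exactness of a function of $(x,\varepsilon)$: $F_\lambda$ is globally exact if there exists $\lambda \ge 0$ such that $F_\lambda$ attains a global minimum on $A \times \mathbb{R}_+$ and every point $(x^*,\varepsilon^*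 )$ of global minimum of $F_\lambda$ on $A\times\mathbb{R}_+$ satisfies $\varepsilon^* = 0$; the greatest lower bound $\lambda^*$ of all such $\lambda\ge 0$ is the exact penalty parameter of $F_\lambda$. Global exactness of a function of $x$ only: $G_\sigma$ is globally exact if there exists $\sigma \ge 0$ such that $G_\sigma$ attains a global minimum on $A$ and every point of global minimum of $G_\sigma$ on $A$ belongs to $\Omega$; the greatest lower bound $\sigma^*$ of all such $\sigma \ge 0$ is its exact penalty parameter. *)

theory Defs
  imports "HOL-Analysis.Analysis"
begin

text \<open>
  The distance is extended-real-valued, so that it is infinite for the empty set;
  \<^const>\<open>infdist\<close> and \<^const>\<open>setdist\<close> return 0 there.
\<close>

definition edist_set :: "'y::metric_space \<Rightarrow> 'y set \<Rightarrow> ereal" where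
  "edist_set y S = (INF z\<in>S. ereal (dist y z))"

definition edom :: "('x \<Rightarrow> ereal) \<Rightarrow> 'x set" where
  "edom f = {x. f x < \<infinity>}"

definition feasible_set :: "('x \<Rightarrow> 'y set) \<Rightarrow> 'x set \<Rightarrow> 'y \<Rightarrow> 'x set" where
  "feasible_set \<Phi> A y0 = {x \<in> A. y0 \<in> \<Phi> x}"

text \<open>
  The case \<open>\<epsilon> = 0\<close> is fixed by convention; values at \<open>\<epsilon> < 0\<close> are never used. For \<open>f\<close> without the
  value \<open>-\<infinity>\<close> no undetermined sum occurs. At \<open>\<sigma> = 0\<close> and infinite distance, the \<^typ>\<open>ereal\<close>
  convention \<open>0 * \<infinity> = 0\<close> applies, so \<open>simple_penalty f \<Phi> y0 0 = f\<close>.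
\<close>

definition smoothing_penalty ::
  "('x \<Rightarrow> ereal) \<Rightarrow> ('x \<Rightarrow> 'y::metric_space set) \<Rightarrow> 'x set \<Rightarrow> 'y \<Rightarrow> real \<Rightarrow> 'x \<times> real \<Rightarrow> ereal" where
  "smoothing_penalty f \<Phi> A y0 lam = (\<lambda>(x, \<epsilon>).
     if \<epsilon> = 0 then (if x \<in> feasible_set \<Phi> A y0 then f x else \<infinity>)
     else f x + ereal (inverse \<epsilon>) * (edist_set y0 (\<Phi> x))\<^sup>2 + ereal (lam * \<epsilon>))"

definition simple_penalty ::
  "('x \<Rightarrow> ereal) \<Rightarrow> ('x \<Rightarrow> 'y::metric_space set) \<Rightarrow> 'y \<Rightarrow> real \<Rightarrow> 'x \<Rightarrow> ereal" where
  "simple_penalty f \<Phi> y0 \<sigma> x = f x + ereal \<sigma> * edist_set y0 (\<Phi> x)"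

text \<open>
  \<open>exact_params S T P\<close>: the parameters \<open>c \<ge> 0\<close> for which \<open>P c\<close> attains its minimum on \<open>S\<close> and all its
  minimizers on \<open>S\<close> lie in \<open>T\<close>. For penalty functions of \<open>(x, \<epsilon>)\<close> take \<open>S = A \<times> [0, \<infinity>)\<close> and
  \<open>T = {(x, \<epsilon>). \<epsilon> = 0}\<close>; for penalty functions of \<open>x\<close> take \<open>S = A\<close> and \<open>T\<close> the feasible set.
\<close>

definition exact_params :: "'p set \<Rightarrow> 'p set \<Rightarrow> (real \<Rightarrow> 'p \<Rightarrow> ereal) \<Rightarrow> real set" where
  "exact_params S T P = {c. 0 \<le> c \<and> (\<exists>p. is_arg_min (P c) (\<lambda>q. q \<in> S) p) \<and>
     (\<forall>p. is_arg_min (P c) (\<lambda>q. q \<in> S) p \<longrightarrow> p \<in> T)}"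

definition globally_exact :: "'p set \<Rightarrow> 'p set \<Rightarrow> (real \<Rightarrow> 'p \<Rightarrow> ereal) \<Rightarrow> bool" where
  "globally_exact S T P \<longleftrightarrow> (\<exists>c. c \<in> exact_params S T P)"

text \<open>The infimum is meaningful only for a globally exact \<open>P\<close>.\<close>

definition exact_penalty_parameter :: "'p set \<Rightarrow> 'p set \<Rightarrow> (real \<Rightarrow> 'p \<Rightarrow> ereal) \<Rightarrow> real" where
  "exact_penalty_parameter S T P = Inf (exact_params S T P)"

end

theory Submission
  imports Defs
begin

text \<open>
  The theorem rests on the arithmetic-geometric mean inequality. Write \<open>\<phi> x\<close> for the distance from \<open>y0\<close>
  to \<open>\<Phi> x\<close>. For \<open>lam > 0\<close> and fixed \<open>x\<close>, the term \<open>\<phi>\<^sup>2 / \<epsilon> + lam * \<epsilon>\<close> is at least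
  \<open>2 * sqrt lam * \<phi>\<close>, with equality at \<open>\<epsilon> = \<phi> / sqrt lam\<close> when \<open>0 < \<phi> < \<infinity>\<close>
  (\<open>young_lower_bound\<close>, \<open>young_attained\<close>). Hence minimizing the smoothing penalty over \<open>\<epsilon>\<close>
  produces the simple penalty with \<open>\<sigma> = 2 * sqrt lam\<close>. Where the distance is finite, the optimal \<open>\<epsilon>\<close>
  is positive exactly at the infeasible points. So \<open>lam > 0\<close> is exact for the former if and only if
  \<open>2 * sqrt lam\<close> is exact for the latter (\<open>exact_smoothing_iff_exact_simple\<close>).

  The value \<open>lam = 0\<close> is never exact for the smoothing penalty: at a feasible minimizer, \<open>\<epsilon>\<close> could then
  be increased at no cost. In contrast, \<open>\<sigma> = 0\<close> can be exact for the simple penalty. This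
  mismatch does not affect the infima, because exactness is inherited by larger \<open>\<sigma>\<close>
  (\<open>exact_simple_mono\<close>): deleting \<open>0\<close> from an up-closed set of nonnegative reals does not
  change its infimum. The relation between the two parameters is then the substitution
  \<open>lam = \<sigma>\<^sup>2 / 4\<close> (\<open>Inf_sqrt_substitution\<close>).
\<close>

section \<open>Minimizers and the distance to a closed set\<close>

lemma is_arg_min_iff_le:
  fixes P :: "'p \<Rightarrow> 'a::linorder"
  shows "is_arg_min P (\<lambda>q. q \<in> S) p \<longleftrightarrow> p \<in> S \<and> (\<forall>q\<in>S. P p \<le> P q)"
  by (auto simp: is_arg_min_def not_less)

lemma edist_set_nonneg: "0 \<le> edist_set y S"
  by (auto simp: edist_set_def intro!: INF_greatest)

text \<open>
  A point outside a closed set has a ball around it that avoids the set. This is why vanishing distance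
  means feasibility.
\<close>

lemma edist_set_eq_0_iff:
  assumes "closed S"
  shows "edist_set y S = 0 \<longleftrightarrow> y \<in> S"
proof
  assume "y \<in> S"
  then have "edist_set y S \<le> ereal (dist y y)"
    unfolding edist_set_def by (rule INF_lower)
  then show "edist_set y S = 0"
    using edist_set_nonneg[of y S] by (simp add: zero_ereal_def[symmetric])
next
  assume zero: "edist_set y S = 0"
  show "y \<in> S"
  proof (rule ccontr)
    assume "y \<notin> S"
    then obtain e where "e > 0" and e: "ball y e \<subseteq> - S"
      using assms open_contains_ball[of "- S"] by (auto simp: open_Compl)
    have "ereal e \<le> edist_set y S"
      unfolding edist_set_def
    proof (rule INF_greatest)
      fix z assume "z \<in> S"
      then have "z \<notin> ball y e" using e by blast
      then show "ereal e \<le> ereal (dist y z)" by simp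
    qed
    with zero \<open>e > 0\<close> show False by simp
  qed
qed

section \<open>Minimizing the smoothing penalty over its second variable\<close>

text \<open>
  The right-hand side exceeds the left-hand side by \<open>(d / sqrt \<epsilon> - sqrt (lam * \<epsilon>))\<^sup>2\<close> for finite \<open>d\<close>;
  for \<open>d = \<infinity>\<close> the right-hand side is infinite.
\<close>

lemma young_lower_bound:
  fixes d :: ereal
  assumes "0 \<le> d" and "0 < \<epsilon>" and "0 \<le> lam"
  shows "ereal (2 * sqrt lam) * d \<le> ereal (inverse \<epsilon>) * d\<^sup>2 + ereal (lam * \<epsilon>)"
proof (cases d)
  case (real r)
  have "0 \<le> (r - sqrt lam * \<epsilon>)\<^sup>2" by simp
  then have "2 * sqrt lam * r * \<epsilon> \<le> r\<^sup>2 + lam * \<epsilon> * \<epsilon>"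
    using \<open>0 \<le> lam\<close> by (simp add: power2_eq_square algebra_simps)
  then have "2 * sqrt lam * r \<le> inverse \<epsilon> * r\<^sup>2 + lam * \<epsilon>"
    using \<open>0 < \<epsilon>\<close> by (simp add: field_simps)
  then show ?thesis using real by simp
next
  case PInf
  then show ?thesis using \<open>0 < \<epsilon>\<close> by simp
next
  case MInf
  then show ?thesis using \<open>0 \<le> d\<close> by simp
qed

lemma young_attained:
  fixes r lam :: real
  assumes "0 < r" and "0 < lam"
  shows "inverse (r / sqrt lam) * r\<^sup>2 + lam * (r / sqrt lam) = 2 * sqrt lam * r"
proof -
  have "lam * (r / sqrt lam) = sqrt lam * r"
    using real_div_sqrt[of lam] assms by (simp add: field_simps)
  moreover have "inverse (r / sqrt lam) * r\<^sup>2 = sqrt lam * r"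
    using assms by (simp add: field_simps power2_eq_square)
  ultimately show ?thesis by simp
qed

lemma smoothing_penalty_ge_simple_penalty:
  assumes "\<And>x. closed (\<Phi> x)" and "0 \<le> lam" and "x \<in> A" and "0 \<le> \<epsilon>"
  shows "simple_penalty f \<Phi> y0 (2 * sqrt lam) x \<le> smoothing_penalty f \<Phi> A y0 lam (x, \<epsilon>)"
proof (cases "\<epsilon> = 0")
  case True
  then show ?thesis
    using assms(1) by (auto simp: smoothing_penalty_def simple_penalty_def feasible_set_def
        edist_set_eq_0_iff[THEN iffD2])
next
  case False
  then have "ereal (2 * sqrt lam) * edist_set y0 (\<Phi> x)
      \<le> ereal (inverse \<epsilon>) * (edist_set y0 (\<Phi> x))\<^sup>2 + ereal (lam * \<epsilon>)"
    using assms by (intro young_lower_bound edist_set_nonneg) auto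
  then show ?thesis
    using False by (simp add: smoothing_penalty_def simple_penalty_def add.assoc add_left_mono)
qed

text \<open>
  The bound above is sharp in \<open>\<epsilon>\<close>, and an infeasible point of finite distance attains it with
  positive \<open>\<epsilon>\<close>. This is what makes an infeasible minimizer of the simple penalty visible as a
  minimizer of the smoothing penalty with \<open>\<epsilon> \<noteq> 0\<close>.
\<close>

lemma smoothing_penalty_eq_simple_penalty:
  assumes "0 < lam" and "0 < edist_set y0 (\<Phi> x)" and "edist_set y0 (\<Phi> x) < \<infinity>"
  obtains \<epsilon> where "0 < \<epsilon>"
    and "smoothing_penalty f \<Phi> A y0 lam (x, \<epsilon>) = simple_penalty f \<Phi> y0 (2 * sqrt lam) x"
proof -
  obtain r where r: "edist_set y0 (\<Phi> x) = ereal r"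
    using assms by (cases "edist_set y0 (\<Phi> x)") auto
  with assms have "0 < r" by simp
  show thesis
  proof
    show "0 < r / sqrt lam" using \<open>0 < r\<close> \<open>0 < lam\<close> by simp
    have "ereal (inverse (r / sqrt lam)) * (ereal r)\<^sup>2 + ereal (lam * (r / sqrt lam))
        = ereal (2 * sqrt lam) * ereal r"
      using young_attained[OF \<open>0 < r\<close> \<open>0 < lam\<close>] by (simp del: inverse_divide)
    then show "smoothing_penalty f \<Phi> A y0 lam (x, r / sqrt lam)
        = simple_penalty f \<Phi> y0 (2 * sqrt lam) x"
      using \<open>0 < r\<close> \<open>0 < lam\<close> r
      by (simp add: smoothing_penalty_def simple_penalty_def add.assoc del: inverse_divide)
  qed
qed

lemma simple_penalty_feasible:
  assumes "\<And>x. closed (\<Phi> x)" and "x \<in> feasible_set \<Phi> A y0"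
  shows "simple_penalty f \<Phi> y0 \<sigma> x = f x"
  using assms by (simp add: simple_penalty_def feasible_set_def edist_set_eq_0_iff[THEN iffD2])

text \<open>
  At a feasible point both penalty terms vanish, which leaves the linear cost of \<open>\<epsilon>\<close>.
\<close>

lemma smoothing_penalty_feasible:
  assumes "\<And>x. closed (\<Phi> x)" and "x \<in> feasible_set \<Phi> A y0"
  shows "smoothing_penalty f \<Phi> A y0 lam (x, \<epsilon>) = f x + ereal (lam * \<epsilon>)"
proof -
  have "edist_set y0 (\<Phi> x) = 0"
    using assms by (simp add: feasible_set_def edist_set_eq_0_iff)
  then show ?thesis
    using assms(2)
    by (simp add: smoothing_penalty_def power2_eq_square zero_ereal_def[symmetric])
qed

section \<open>Exact parameters of the two penalty functions\<close>

text \<open>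
  Raising \<open>\<sigma>\<close> raises the penalty function everywhere and keeps its values on the feasible set. An
  exact minimizer therefore stays optimal with the same value, and no new minimizers appear.
\<close>

lemma exact_simple_mono:
  assumes closed: "\<And>x. closed (\<Phi> x)"
    and exact: "\<sigma> \<in> exact_params A (feasible_set \<Phi> A y0) (simple_penalty f \<Phi> y0)"
    and "\<sigma> \<le> \<tau>"
  shows "\<tau> \<in> exact_params A (feasible_set \<Phi> A y0) (simple_penalty f \<Phi> y0)"
proof -
  let ?G = "simple_penalty f \<Phi> y0" and ?\<Omega> = "feasible_set \<Phi> A y0"
  have le: "?G \<sigma> x \<le> ?G \<tau> x" for x
    using \<open>\<sigma> \<le> \<tau>\<close> unfolding simple_penalty_def
    by (intro add_left_mono ereal_mult_right_mono) (auto simp: edist_set_nonneg)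
  obtain x where x: "x \<in> A" "\<And>q. q \<in> A \<Longrightarrow> ?G \<sigma> x \<le> ?G \<sigma> q" and "x \<in> ?\<Omega>"
    using exact by (auto simp: exact_params_def is_arg_min_iff_le)
  have eq: "?G \<tau> x = ?G \<sigma> x"
    using closed \<open>x \<in> ?\<Omega>\<close> by (simp add: simple_penalty_feasible)
  have "?G \<tau> x \<le> ?G \<tau> q" if "q \<in> A" for q
    using x(2)[OF that] le[of q] eq by simp
  moreover have "p \<in> ?\<Omega>" if p: "p \<in> A" "\<forall>q\<in>A. ?G \<tau> p \<le> ?G \<tau> q" for p
  proof -
    have "?G \<sigma> p \<le> ?G \<sigma> x"
      using le[of p] p(2) x(1) eq by (metis order_trans)
    then have "\<forall>q\<in>A. ?G \<sigma> p \<le> ?G \<sigma> q"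
      using x(2) order_trans by blast
    with p(1) exact show ?thesis
      by (auto simp: exact_params_def is_arg_min_iff_le)
  qed
  ultimately show ?thesis
    using x(1) exact \<open>\<sigma> \<le> \<tau>\<close> by (auto simp: exact_params_def is_arg_min_iff_le)
qed

text \<open>
  Both directions compare the two functions at a feasible minimizer, where they share a value. That value is
  finite, because some feasible point has a finite objective value and \<open>f\<close> avoids \<open>-\<infinity>\<close>; finiteness rules out the points of
  infinite distance, and lets the cost \<open>lam * \<epsilon>\<close> separate \<open>\<epsilon> = 0\<close> from \<open>\<epsilon> > 0\<close>.
\<close>

lemma exact_smoothing_iff_exact_simple:
  fixes f :: "'x \<Rightarrow> ereal" and \<Phi> :: "'x \<Rightarrow> 'y::metric_space set"
  assumes f: "\<And>x. f x \<noteq> -\<infinity>"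
    and closed: "\<And>x. closed (\<Phi> x)"
    and dom: "feasible_set \<Phi> A y0 \<inter> edom f \<noteq> {}"
  shows "lam \<in> exact_params (A \<times> {0..}) {(x, \<epsilon>). \<epsilon> = 0} (smoothing_penalty f \<Phi> A y0)
    \<longleftrightarrow> 0 < lam \<and> 2 * sqrt lam \<in> exact_params A (feasible_set \<Phi> A y0) (simple_penalty f \<Phi> y0)"
    (is "?exF \<longleftrightarrow> 0 < lam \<and> ?exG")
proof
  let ?F = "smoothing_penalty f \<Phi> A y0 lam" and ?G = "simple_penalty f \<Phi> y0 (2 * sqrt lam)"
    and ?\<Omega> = "feasible_set \<Phi> A y0"
  note F_feas = smoothing_penalty_feasible[where \<Phi> = \<Phi>, OF closed] and G_feas = simple_penalty_feasible[where \<Phi> = \<Phi> and A = A, OF closed]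
  obtain z where z: "z \<in> ?\<Omega>" "f z < \<infinity>"
    using dom by (auto simp: edom_def)
  {
    assume ?exF
    then have "0 \<le> lam"
      and min_eps: "\<And>p \<epsilon>. p \<in> A \<Longrightarrow> 0 \<le> \<epsilon> \<Longrightarrow> \<forall>q\<in>A \<times> {0..}. ?F (p, \<epsilon>) \<le> ?F q \<Longrightarrow> \<epsilon> = 0"
      by (auto simp: exact_params_def is_arg_min_iff_le)
    obtain x where "x \<in> A" and x_min: "\<And>q \<epsilon>. q \<in> A \<Longrightarrow> 0 \<le> \<epsilon> \<Longrightarrow> ?F (x, 0) \<le> ?F (q, \<epsilon>)"
      using \<open>?exF\<close> by (fastforce simp: exact_params_def is_arg_min_iff_le)
    have "z \<in> A" using z(1) by (simp add: feasible_set_def)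
    have "?F (x, 0) \<le> f z"
      using x_min[OF \<open>z \<in> A\<close>, of 0] z(1) by (simp add: F_feas zero_ereal_def[symmetric])
    then have "?F (x, 0) < \<infinity>" using z(2) by (rule le_less_trans)
    then have "x \<in> ?\<Omega>" by (auto simp: smoothing_penalty_def split: if_splits)
    then have Fx: "?F (x, 0) = f x" by (simp add: F_feas zero_ereal_def[symmetric])
    have "lam \<noteq> 0"
    proof
      \<comment> \<open>At a feasible point, every \<open>\<epsilon>\<close> has the same value when \<open>lam = 0\<close>; \<open>\<epsilon> = 1\<close> is one choice.\<close>
      assume "lam = 0"
      then have "?F (x, 1) = ?F (x, 0)"
        using \<open>x \<in> ?\<Omega>\<close> by (simp add: F_feas)
      then have "\<forall>q\<in>A \<times> {0..}. ?F (x, 1) \<le> ?F q"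
        using x_min by auto
      from min_eps[OF \<open>x \<in> A\<close> _ this] show False by simp
    qed
    with \<open>0 \<le> lam\<close> have "0 < lam" by simp
    have attained: "\<exists>\<epsilon>\<ge>0. ?F (q, \<epsilon>) = ?G q \<and> (q \<notin> ?\<Omega> \<longrightarrow> \<epsilon> \<noteq> 0)"
      if "q \<in> A" "?G q < \<infinity>" for q
    proof (cases "q \<in> ?\<Omega>")
      case True
      then show ?thesis
        by (intro exI[of _ 0]) (simp add: F_feas G_feas zero_ereal_def[symmetric])
    next
      case False
      with \<open>q \<in> A\<close> have "edist_set y0 (\<Phi> q) \<noteq> 0"
        by (simp add: feasible_set_def edist_set_eq_0_iff closed)
      then have "0 < edist_set y0 (\<Phi> q)"
        using edist_set_nonneg[of y0 "\<Phi> q"] by (simp add: less_le)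
      moreover have "edist_set y0 (\<Phi> q) < \<infinity>"
        using \<open>?G q < \<infinity>\<close> \<open>0 < lam\<close> f[of q]
        by (cases "edist_set y0 (\<Phi> q)"; cases "f q") (auto simp: simple_penalty_def)
      ultimately show ?thesis
        using \<open>0 < lam\<close> smoothing_penalty_eq_simple_penalty[of lam y0 \<Phi> q f A]
        by (metis less_le)
    qed
    have G_min: "?G x \<le> ?G q" if "q \<in> A" for q
    proof (cases "?G q < \<infinity>")
      case True
      with attained[OF that] obtain \<epsilon> where "0 \<le> \<epsilon>" "?F (q, \<epsilon>) = ?G q" by blast
      with x_min[OF that, of \<epsilon>] show ?thesis
        by (simp add: Fx G_feas \<open>x \<in> ?\<Omega>\<close>)
    qed simp
    have "p \<in> ?\<Omega>" if p: "p \<in> A" "\<forall>q\<in>A. ?G p \<le> ?G q" for p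
    proof (rule ccontr)
      assume "p \<notin> ?\<Omega>"
      have "?G x = f x" using \<open>x \<in> ?\<Omega>\<close> by (rule G_feas)
      then have "?G p = ?F (x, 0)"
        using p(2) \<open>x \<in> A\<close> G_min[OF p(1)] by (metis Fx antisym)
      with attained[OF p(1)] \<open>?F (x, 0) < \<infinity>\<close> \<open>p \<notin> ?\<Omega>\<close>
      obtain \<epsilon> where "0 \<le> \<epsilon>" "\<epsilon> \<noteq> 0" "?F (p, \<epsilon>) = ?F (x, 0)" by auto
      with min_eps[OF p(1) \<open>0 \<le> \<epsilon>\<close>] x_min show False by auto
    qed
    with \<open>x \<in> A\<close> G_min \<open>0 < lam\<close> show "0 < lam \<and> ?exG"
      by (auto simp: exact_params_def is_arg_min_iff_le)
  next
    assume "0 < lam \<and> ?exG"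
    then have "0 < lam"
      and min_feas: "\<And>p. p \<in> A \<Longrightarrow> \<forall>q\<in>A. ?G p \<le> ?G q \<Longrightarrow> p \<in> ?\<Omega>"
      by (auto simp: exact_params_def is_arg_min_iff_le)
    obtain x where "x \<in> A" and x_min: "\<And>q. q \<in> A \<Longrightarrow> ?G x \<le> ?G q"
      using \<open>0 < lam \<and> ?exG\<close> by (auto simp: exact_params_def is_arg_min_iff_le)
    then have "x \<in> ?\<Omega>" using min_feas by blast
    then have Gx: "?G x = f x" and Fx: "?F (x, 0) = f x"
      by (simp_all add: F_feas G_feas zero_ereal_def[symmetric])
    have F_ge_G: "?G q \<le> ?F (q, \<epsilon>)" if "q \<in> A" "0 \<le> \<epsilon>" for q \<epsilon>
      using smoothing_penalty_ge_simple_penalty[where \<Phi> = \<Phi>, OF closed] \<open>0 < lam\<close> that by simp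
    have F_min: "?F (x, 0) \<le> ?F (q, \<epsilon>)" if "q \<in> A" "0 \<le> \<epsilon>" for q \<epsilon>
      using x_min[OF that(1)] F_ge_G[OF that] by (simp add: Gx Fx)
    have "\<epsilon> = 0" if p: "p \<in> A" "0 \<le> \<epsilon>" "\<forall>q\<in>A \<times> {0..}. ?F (p, \<epsilon>) \<le> ?F q" for p \<epsilon>
    proof -
      have F_le: "?F (p, \<epsilon>) \<le> f x"
        using p(3) \<open>x \<in> A\<close> by (auto simp: Fx[symmetric])
      have "?G p \<le> ?G x"
        using F_ge_G[OF p(1,2)] F_le by (simp add: Gx)
      then have "p \<in> ?\<Omega>"
        using min_feas[OF p(1)] x_min order_trans by blast
      have "f x \<le> f p"
        using x_min[OF p(1)] by (simp add: Gx G_feas \<open>p \<in> ?\<Omega>\<close>)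
      have "f x \<le> f z"
        using x_min[of z] z(1) by (simp add: Gx G_feas feasible_set_def)
      then have "f x \<noteq> \<infinity>" using z(2) by auto
      have "f p + ereal (lam * \<epsilon>) \<le> f x"
        using F_le by (simp add: F_feas \<open>p \<in> ?\<Omega>\<close>)
      with \<open>f x \<le> f p\<close> \<open>f x \<noteq> \<infinity>\<close> f[of x] f[of p] have "lam * \<epsilon> \<le> 0"
        by (cases "f x"; cases "f p") auto
      with \<open>0 < lam\<close> \<open>0 \<le> \<epsilon>\<close> show "\<epsilon> = 0"
        by (simp add: mult_le_0_iff)
    qed
    moreover have "is_arg_min ?F (\<lambda>q. q \<in> A \<times> {0..}) (x, 0)"
      using \<open>x \<in> A\<close> F_min by (auto simp: is_arg_min_iff_le)
    ultimately show ?exF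
      using \<open>0 < lam\<close> by (auto simp: exact_params_def is_arg_min_iff_le)
  }
qed

section \<open>Comparison of the exact penalty parameters\<close>

text \<open>
  Every \<open>c > Inf S\<close> lies in \<open>S\<close> because \<open>S\<close> is up-closed, and it is positive because \<open>Inf S \<ge> 0\<close>.
  Hence the positive elements of \<open>S\<close> alone determine \<open>Inf S\<close>.
\<close>

lemma Inf_sqrt_substitution:
  fixes S :: "real set"
  assumes "S \<noteq> {}" and nonneg: "\<And>s. s \<in> S \<Longrightarrow> 0 \<le> s"
    and up: "\<And>s t. s \<in> S \<Longrightarrow> s \<le> t \<Longrightarrow> t \<in> S"
  shows "Inf {lam. 0 < lam \<and> 2 * sqrt lam \<in> S} = (Inf S)\<^sup>2 / 4"
proof -
  let ?T = "{lam. 0 < lam \<and> 2 * sqrt lam \<in> S}"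
  have bdd: "bdd_below S" using nonneg by (rule bdd_belowI)
  have "0 \<le> Inf S" using \<open>S \<noteq> {}\<close> nonneg by (rule cInf_greatest)
  have above: "c\<^sup>2 / 4 \<in> ?T" if "Inf S < c" for c
  proof -
    obtain s where "s \<in> S" "s < c" using cInf_lessD[OF \<open>S \<noteq> {}\<close> \<open>Inf S < c\<close>] by blast
    then have "c \<in> S" using up by simp
    moreover have "0 < c" using \<open>0 \<le> Inf S\<close> \<open>Inf S < c\<close> by simp
    ultimately show ?thesis by (simp add: real_sqrt_divide)
  qed
  show ?thesis
  proof (rule cInf_eq_non_empty)
    show "?T \<noteq> {}" using above[of "Inf S + 1"] by (metis empty_iff less_add_one)
  next
    fix lam assume "lam \<in> ?T"
    then have "0 < lam" "Inf S \<le> 2 * sqrt lam" using bdd by (auto intro: cInf_lower)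
    then have "(Inf S)\<^sup>2 \<le> (2 * sqrt lam)\<^sup>2" using \<open>0 \<le> Inf S\<close> by (intro power_mono)
    then show "(Inf S)\<^sup>2 / 4 \<le> lam" using \<open>0 < lam\<close> by (simp add: power_mult_distrib)
  next
    fix y assume y: "\<And>lam. lam \<in> ?T \<Longrightarrow> y \<le> lam"
    have "((\<lambda>c. c\<^sup>2 / 4) \<longlongrightarrow> (Inf S)\<^sup>2 / 4) (at_right (Inf S))"
      by (intro tendsto_intros) simp_all
    moreover have "\<forall>\<^sub>F c in at_right (Inf S). y \<le> c\<^sup>2 / 4"
      using y[OF above] by (auto simp: eventually_at_filter)
    ultimately show "y \<le> (Inf S)\<^sup>2 / 4"
      by (rule tendsto_lowerbound) simp
  qed
qed

theorem theorem2:
  fixes f :: "'x::topological_space \<Rightarrow> ereal"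
    and \<Phi> :: "'x \<Rightarrow> 'y::metric_space set"
    and A :: "'x set"
    and y0 :: 'y
  assumes "\<And>x. f x \<noteq> -\<infinity>"
    and "\<And>x. closed (\<Phi> x)"
    and "A \<noteq> {}"
    and "feasible_set \<Phi> A y0 \<inter> edom f \<noteq> {}"
    and "\<exists>m::real. \<forall>x\<in>feasible_set \<Phi> A y0. ereal m \<le> f x"
  shows "(globally_exact (A \<times> {0..}) {(x, \<epsilon>). \<epsilon> = 0} (smoothing_penalty f \<Phi> A y0)
            \<longleftrightarrow> globally_exact A (feasible_set \<Phi> A y0) (simple_penalty f \<Phi> y0))
       \<and> (globally_exact (A \<times> {0..}) {(x, \<epsilon>). \<epsilon> = 0} (smoothing_penalty f \<Phi> A y0) \<longrightarrow>
            exact_penalty_parameter (A \<times> {0..}) {(x, \<epsilon>). \<epsilon> = 0} (smoothing_penalty f \<Phi> A y0)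
            = (exact_penalty_parameter A (feasible_set \<Phi> A y0) (simple_penalty f \<Phi> y0))\<^sup>2 / 4)"
proof -
  let ?PF = "exact_params (A \<times> {0..}) {(x, \<epsilon>). \<epsilon> = 0} (smoothing_penalty f \<Phi> A y0)"
    and ?PG = "exact_params A (feasible_set \<Phi> A y0) (simple_penalty f \<Phi> y0)"
  have PF: "?PF = {lam. 0 < lam \<and> 2 * sqrt lam \<in> ?PG}"
    using exact_smoothing_iff_exact_simple[OF assms(1,2,4)] by blast
  have up: "t \<in> ?PG" if "s \<in> ?PG" "s \<le> t" for s t
    using exact_simple_mono[OF assms(2) that] .
  have nonneg: "0 \<le> s" if "s \<in> ?PG" for s
    using that by (simp add: exact_params_def)
  have nonempty: "?PF \<noteq> {} \<longleftrightarrow> ?PG \<noteq> {}"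
  proof
    assume "?PG \<noteq> {}"
    then obtain s where s: "s \<in> ?PG" by blast
    \<comment> \<open>Moving up by one avoids \<open>s = 0\<close>, which corresponds to the inexact value \<open>lam = 0\<close>.\<close>
    have "2 * sqrt (((s + 1) / 2)\<^sup>2) = s + 1"
      using nonneg[OF s] by simp
    then have "2 * sqrt (((s + 1) / 2)\<^sup>2) \<in> ?PG"
      using up[OF s, of "s + 1"] by (simp only:)
    moreover have "0 < ((s + 1) / 2)\<^sup>2"
      using nonneg[OF s] by simp
    ultimately show "?PF \<noteq> {}" unfolding PF by blast
  qed (use PF in blast)
  then have "globally_exact (A \<times> {0..}) {(x, \<epsilon>). \<epsilon> = 0} (smoothing_penalty f \<Phi> A y0)
      \<longleftrightarrow> globally_exact A (feasible_set \<Phi> A y0) (simple_penalty f \<Phi> y0)"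
    unfolding globally_exact_def by blast
  moreover have "Inf ?PF = (Inf ?PG)\<^sup>2 / 4" if "?PF \<noteq> {}"
    unfolding PF using that nonempty nonneg up by (intro Inf_sqrt_substitution) auto
  ultimately show ?thesis
    unfolding exact_penalty_parameter_def globally_exact_def by blast
qed

end
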